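(* For each $i=1,\dots,n$, let $A_i\subset\mathbb{R}^n$ be a compact convex set whose interior is non-empty and let $f_i:\mathbb{R}^n\times S^n\to\mathbb{R}$ be continuous. Assume that, for every $i=1,\dots,n$, every boundary point $x$ of $A_i$ and every supporting hyperplane $H$ of $A_i$ at $x$, the set $A_i\cap H$ is a singleton. Then the mapping $\psi=(\psi_1,\dots,\psi_n):S^n\to\mathbb{R}^n$ defined by $$\psi_i(\mathbf{u}):=\begin{cases}\displaystyle\max_{x\in A_i\cap H_{\mathbf{u}}^+}f_i(x,\mathbf{u})-\min_{x\in A_i\cap H_{\mathbf{u}}^+}f_i(x,\mathbf{u}) & (A_i\cap H_{\mathbf{u}}^+\neq\emptyset),\\ 0 & (A_i\cap H_{\mathbf{u}}^+=\emptyset)\end{cases}$$ is continuous on the whole set $S^n$.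
   Context: $S^n$ is the unit sphere in $\mathbb{R}^{n+1}$. A point $\mathbf{u}=(u_1,\dots,u_n,u_{n+1})\in S^n$ is written $\mathbf{u}=(u,u_{n+1})$ with $u=(u_1,\dots,u_n)\in\mathbb{R}^n$, and $H_{\mathbf{u}}^+=\{x\in\mathbb{R}^n\mid\langle u,x\rangle\ge u_{n+1}\}$, where $\langle u,x\rangle=u_1x_1+\cdots+u_nx_n$. (If $u=0$, then $H_{\mathbf{u}}^+$ is either $\mathbb{R}^n$ or empty.) *)

theory Defs
  imports "HOL-Analysis.Analysis"
begin

text \<open>
  The space of dimension \<open>n\<close> is \<^typ>\<open>real ^ 'n\<close>, and the space of dimension \<open>n + 1\<close> is
  \<^typ>\<open>(real ^ 'n) \<times> real\<close>, whose norm is the Euclidean one. A point \<open>(u, u\<^sub>n\<^sub>+\<^sub>1)\<close> of the unit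
  sphere is thus a pair in \<^term>\<open>sphere (0 :: (real ^ 'n) \<times> real) 1\<close>.
\<close>

definition halfspace_plus :: "'a::euclidean_space \<times> real \<Rightarrow> 'a set"
  where "halfspace_plus u = {x. inner (fst u) x \<ge> snd u}"

text \<open>One inequality suffices, since \<open>(a, b)\<close> may be replaced by \<open>(- a, - b)\<close>.\<close>

definition supporting_hyperplane_at :: "'a::euclidean_space set \<Rightarrow> 'a \<Rightarrow> 'a set \<Rightarrow> bool"
  where "supporting_hyperplane_at A x H \<longleftrightarrow>
    (\<exists>a b. a \<noteq> 0 \<and> H = {y. inner a y = b} \<and> x \<in> A \<inter> H \<and> A \<subseteq> {y. inner a y \<le> b})"

text \<open>
  The maximum and minimum are those of the set of values, an infinite set in general, hence
  \<^const>\<open>Greatest\<close> and \<^const>\<open>Least\<close> instead of \<^const>\<open>Max\<close> and \<^const>\<open>Min\<close>. They are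
  attained when \<open>f i\<close> is continuous and \<open>A i\<close> is compact.
\<close>

definition psi ::
  "('n::finite \<Rightarrow> (real ^ 'n) set) \<Rightarrow>
   ('n \<Rightarrow> (real ^ 'n) \<times> ((real ^ 'n) \<times> real) \<Rightarrow> real) \<Rightarrow>
   (real ^ 'n) \<times> real \<Rightarrow> real ^ 'n"
  where "psi A f u = (\<chi> i.
    if A i \<inter> halfspace_plus u \<noteq> {}
    then (GREATEST y. y \<in> (\<lambda>x. f i (x, u)) ` (A i \<inter> halfspace_plus u))
       - (LEAST y. y \<in> (\<lambda>x. f i (x, u)) ` (A i \<inter> halfspace_plus u))
    else 0)"

end

theory Submission
  imports Defs
begin

text \<open>
  Work with one body \<open>A\<close> and one function \<open>f\<close>, and let \<open>F u = A \<inter> H\<^sub>u\<^sup>+\<close>. Where \<open>F u\<close> is not empty,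
  the difference of maximum and minimum is the largest value of \<open>f (x, u) - f (y, u)\<close> for
  \<open>x, y \<in> F u\<close>; in particular it is nonnegative, so that the value \<open>0\<close> for empty \<open>F u\<close> is the least
  value possible. Hence the sets where the difference is at least \<open>c > 0\<close> or exceeds \<open>c \<ge> 0\<close> decide
  continuity, and both can be described by pairs.

  Upper semicontinuity (\<open>closed_gap_ge\<close>): the condition that some pair in \<open>F u\<close> reaches the level
  \<open>c > 0\<close> is a projection of a compact set of triples \<open>(x, y, u)\<close>, so it is closed in \<open>u\<close>.

  Lower semicontinuity (\<open>openin_gap_gt\<close>): the condition that some pair exceeds the level \<open>c \<ge> 0\<close>
  would be visibly open in \<open>u\<close> if the pair lay in the open half space \<open>\<langle>u, x\<rangle> > u\<^sub>n\<^sub>+\<^sub>1\<close>. It can be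
  moved there: a pair that exceeds \<open>c \<ge> 0\<close> has two different points, and if \<open>A\<close> had no point in the
  open half space, then the bounding hyperplane would support \<open>A\<close> and meet it in both of them,
  contrary to the hypothesis. Sliding the pair towards a point of \<open>A\<close> in the open half space keeps
  it in \<open>A\<close> by convexity and changes the values of \<open>f\<close> as little as desired.
\<close>

definition gap :: "'a::euclidean_space set \<Rightarrow> ('a \<times> ('a \<times> real) \<Rightarrow> real) \<Rightarrow> 'a \<times> real \<Rightarrow> real"
  where "gap A f u =
    (if A \<inter> halfspace_plus u \<noteq> {}
     then (GREATEST y. y \<in> (\<lambda>x. f (x, u)) ` (A \<inter> halfspace_plus u))
        - (LEAST y. y \<in> (\<lambda>x. f (x, u)) ` (A \<inter> halfspace_plus u))
     else 0)"

lemma psi_nth: "psi A f u $ i = gap (A i) (f i) u"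
  by (simp add: psi_def gap_def)

lemma closed_halfspace_plus: "closed (halfspace_plus u)"
  unfolding halfspace_plus_def using closed_halfspace_ge[of "snd u" "fst u"] by simp

lemma gap_extremal:
  fixes A :: "'a::euclidean_space set"
  assumes "compact A" and "continuous_on (A \<times> S) f" and "u \<in> S"
    and ne: "A \<inter> halfspace_plus u \<noteq> {}"
  obtains x y where "x \<in> A \<inter> halfspace_plus u" "y \<in> A \<inter> halfspace_plus u"
    and "gap A f u = f (x, u) - f (y, u)"
    and "\<And>x' y'. x' \<in> A \<inter> halfspace_plus u \<Longrightarrow> y' \<in> A \<inter> halfspace_plus u
          \<Longrightarrow> f (x', u) - f (y', u) \<le> gap A f u"
proof -
  let ?F = "A \<inter> halfspace_plus u"
  have comp: "compact ?F"
    using \<open>compact A\<close> closed_halfspace_plus by (rule compact_Int_closed)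
  have cont: "continuous_on ?F (\<lambda>x. f (x, u))"
    using \<open>u \<in> S\<close> by (intro continuous_on_compose2[OF assms(2)] continuous_intros) auto
  obtain x where x: "x \<in> ?F" "\<And>z. z \<in> ?F \<Longrightarrow> f (z, u) \<le> f (x, u)"
    using continuous_attains_sup[OF comp ne cont] by blast
  obtain y where y: "y \<in> ?F" "\<And>z. z \<in> ?F \<Longrightarrow> f (y, u) \<le> f (z, u)"
    using continuous_attains_inf[OF comp ne cont] by blast
  have "(GREATEST v. v \<in> (\<lambda>x. f (x, u)) ` ?F) = f (x, u)"
    using x by (intro Greatest_equality) auto
  moreover have "(LEAST v. v \<in> (\<lambda>x. f (x, u)) ` ?F) = f (y, u)"
    using y by (intro Least_equality) auto
  ultimately have eq: "gap A f u = f (x, u) - f (y, u)"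
    using ne by (simp add: gap_def)
  show thesis
  proof (rule that[OF x(1) y(1) eq])
    fix x' y' assume "x' \<in> ?F" "y' \<in> ?F"
    then show "f (x', u) - f (y', u) \<le> gap A f u"
      unfolding eq using x(2) y(2) by (intro diff_mono) auto
  qed
qed

lemma gap_nonneg:
  fixes A :: "'a::euclidean_space set"
  assumes "compact A" and "continuous_on (A \<times> S) f" and "u \<in> S"
  shows "0 \<le> gap A f u"
proof (cases "A \<inter> halfspace_plus u = {}")
  case True
  then show ?thesis by (simp add: gap_def)
next
  case False
  then obtain z where z: "z \<in> A \<inter> halfspace_plus u" by blast
  from gap_extremal[OF assms False] show ?thesis
    using z by (metis diff_self)
qed

text \<open>
  A limit of parameters with a pair reaching the level \<open>c\<close> has such a pair too, by compactness of
  \<open>A\<close>. Positivity of \<open>c\<close> ensures that every \<open>u\<close> in the set has a nonempty section and thus a pair.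
\<close>

lemma closed_gap_ge:
  fixes A :: "'a::euclidean_space set"
  assumes "compact A" and "compact S" and contf: "continuous_on (A \<times> S) f" and "0 < c"
  shows "closed {u \<in> S. c \<le> gap A f u}"
proof -
  define P where "P = A \<times> A \<times> S"
  define T where "T = P \<inter> {p \<in> P. snd (snd (snd p)) \<le> fst (snd (snd p)) \<bullet> fst p}
    \<inter> {p \<in> P. snd (snd (snd p)) \<le> fst (snd (snd p)) \<bullet> fst (snd p)}
    \<inter> {p \<in> P. c \<le> f (fst p, snd (snd p)) - f (fst (snd p), snd (snd p))}"
  have "compact P"
    unfolding P_def using assms by (intro compact_Times)
  then have "closed P" by (rule compact_imp_closed)
  have "continuous_on P (\<lambda>p. f (fst p, snd (snd p)) - f (fst (snd p), snd (snd p)))"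
    unfolding P_def
    by (intro continuous_on_diff continuous_on_compose2[OF contf] continuous_intros) auto
  then have "compact T"
    unfolding T_def
    by (intro compact_Int_closed \<open>compact P\<close> continuous_on_closed_Collect_le \<open>closed P\<close>)
      (assumption | intro continuous_intros)+
  then have "closed ((\<lambda>p. snd (snd p)) ` T)"
    by (intro compact_imp_closed compact_continuous_image continuous_intros)
  also have "(\<lambda>p. snd (snd p)) ` T = {u \<in> S. c \<le> gap A f u}" (is "_ = ?R")
  proof (intro subset_antisym subsetI)
    fix u assume "u \<in> (\<lambda>p. snd (snd p)) ` T"
    then obtain x y where u: "u \<in> S" and "x \<in> A \<inter> halfspace_plus u" "y \<in> A \<inter> halfspace_plus u"
      and le: "c \<le> f (x, u) - f (y, u)"
      by (auto simp: T_def P_def halfspace_plus_def)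
    then have "f (x, u) - f (y, u) \<le> gap A f u"
      using gap_extremal[OF \<open>compact A\<close> contf u] by blast
    with u le show "u \<in> ?R" by simp
  next
    fix u assume "u \<in> ?R"
    then have u: "u \<in> S" and le: "c \<le> gap A f u" by auto
    have "A \<inter> halfspace_plus u \<noteq> {}"
      using le \<open>0 < c\<close> by (auto simp: gap_def)
    from gap_extremal[OF \<open>compact A\<close> contf u this] obtain x y
      where "x \<in> A \<inter> halfspace_plus u" "y \<in> A \<inter> halfspace_plus u"
        and "gap A f u = f (x, u) - f (y, u)" by metis
    then have "(x, y, u) \<in> T"
      using u le by (auto simp: T_def P_def halfspace_plus_def)
    then show "u \<in> (\<lambda>p. snd (snd p)) ` T" by force
  qed
  finally show ?thesis .
qed

lemma frontier_if_supporting_hyperplane_at: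
  fixes A :: "'a::euclidean_space set"
  assumes "supporting_hyperplane_at A x H"
  shows "x \<in> frontier A"
proof -
  obtain a b where "a \<noteq> 0" "inner a x = b" "x \<in> A" "A \<subseteq> {y. inner a y \<le> b}"
    using assms by (auto simp: supporting_hyperplane_at_def)
  moreover have "interior A \<subseteq> {y. inner a y < b}"
    using interior_mono[OF \<open>A \<subseteq> {y. inner a y \<le> b}\<close>] \<open>a \<noteq> 0\<close> by simp
  ultimately show ?thesis
    using closure_subset by (fastforce simp: frontier_def)
qed

text \<open>
  Otherwise the bounding hyperplane of the half space would support \<open>A\<close> and contain both points.
  That \<open>u\<close> lies on the sphere matters when \<open>fst u = 0\<close>, where there is no hyperplane: then
  \<open>snd u\<close> is \<open>1\<close> or \<open>-1\<close>, so the half space is empty or every point satisfies the strict inequality.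
\<close>

lemma ex_strict_point:
  fixes A :: "'a::euclidean_space set"
  assumes single: "\<And>z H. z \<in> frontier A \<Longrightarrow> supporting_hyperplane_at A z H
      \<Longrightarrow> is_singleton (A \<inter> H)"
    and u: "u \<in> sphere 0 1"
    and x: "x \<in> A \<inter> halfspace_plus u" and y: "y \<in> A \<inter> halfspace_plus u" and "x \<noteq> y"
  shows "\<exists>p\<in>A. snd u < fst u \<bullet> p"
proof (rule ccontr)
  assume "\<not> ?thesis"
  then have le: "\<And>p. p \<in> A \<Longrightarrow> fst u \<bullet> p \<le> snd u" by force
  then have on: "fst u \<bullet> x = snd u" "fst u \<bullet> y = snd u"
    using x y by (auto simp: halfspace_plus_def intro: antisym)
  have "fst u \<noteq> 0"
  proof
    assume "fst u = 0"
    with on have "u = 0" by (simp add: prod_eq_iff)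
    with u show False by simp
  qed
  then have "supporting_hyperplane_at A x {z. fst u \<bullet> z = snd u}"
    unfolding supporting_hyperplane_at_def using le on x by blast
  then have "is_singleton (A \<inter> {z. fst u \<bullet> z = snd u})"
    using single frontier_if_supporting_hyperplane_at by blast
  moreover have "x \<in> A \<inter> {z. fst u \<bullet> z = snd u}" "y \<in> A \<inter> {z. fst u \<bullet> z = snd u}"
    using x y on by auto
  ultimately show False
    using \<open>x \<noteq> y\<close> by (metis is_singletonE singletonD)
qed

lemma openin_strict_pair:
  fixes A :: "'a::euclidean_space set" and f :: "'a \<times> ('a \<times> real) \<Rightarrow> real"
  assumes contf: "continuous_on (A \<times> S) f" and "x \<in> A" and "y \<in> A"
  shows "openin (top_of_set S)
    {u \<in> S. snd u < fst u \<bullet> x \<and> snd u < fst u \<bullet> y \<and> c < f (x, u) - f (y, u)}"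
proof -
  have *: "openin (top_of_set S) {u \<in> S. 0 < h u}" if "continuous_on S h" for h :: "_ \<Rightarrow> real"
    using continuous_openin_preimage_gen[OF that open_greaterThan[of 0]]
    by (simp add: vimage_def Int_def)
  have "continuous_on S (\<lambda>u. f (x, u) - f (y, u) - c)"
    using assms by (intro continuous_on_diff continuous_on_compose2[OF contf] continuous_intros) auto
  from openin_Int[OF openin_Int[OF *[of "\<lambda>u. fst u \<bullet> x - snd u"] *[of "\<lambda>u. fst u \<bullet> y - snd u"]]
      *[OF this]]
  have "openin (top_of_set S) ({u \<in> S. 0 < fst u \<bullet> x - snd u} \<inter> {u \<in> S. 0 < fst u \<bullet> y - snd u}
      \<inter> {u \<in> S. 0 < f (x, u) - f (y, u) - c})"
    by (simp add: continuous_intros)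
  then show ?thesis
    by (rule back_subst[of "openin (top_of_set S)"]) auto
qed

text \<open>
  An extremal pair is slid towards a point in the open half space. Since \<open>f\<close> is continuous, a short
  slide keeps the difference above \<open>c\<close>, while any positive one makes the half space inequality
  strict.
\<close>

lemma strict_pair_if_gap_gt:
  fixes A :: "'a::euclidean_space set"
  assumes "compact A" and "convex A"
    and contf: "continuous_on (A \<times> sphere 0 1) f"
    and single: "\<And>z H. z \<in> frontier A \<Longrightarrow> supporting_hyperplane_at A z H
      \<Longrightarrow> is_singleton (A \<inter> H)"
    and u: "u \<in> sphere 0 1" and "0 \<le> c" and gt: "c < gap A f u"
  shows "\<exists>x\<in>A. \<exists>y\<in>A. snd u < fst u \<bullet> x \<and> snd u < fst u \<bullet> y \<and> c < f (x, u) - f (y, u)"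
proof -
  have "A \<inter> halfspace_plus u \<noteq> {}"
    using assms by (auto simp: gap_def)
  from gap_extremal[OF \<open>compact A\<close> contf u this] obtain x y
    where x: "x \<in> A \<inter> halfspace_plus u" and y: "y \<in> A \<inter> halfspace_plus u"
      and eq: "gap A f u = f (x, u) - f (y, u)" by metis
  have "x \<noteq> y" using eq gt \<open>0 \<le> c\<close> by auto
  with single u x y have "\<exists>p\<in>A. snd u < fst u \<bullet> p"
    by (rule ex_strict_point)
  then obtain p where p: "p \<in> A" "snd u < fst u \<bullet> p" by blast
  \<comment> \<open>\<open>slide z t\<close> moves from \<open>z\<close> at \<open>t = 0\<close> to \<open>p\<close> at \<open>t = 1\<close>.\<close>
  define slide where "slide z t = (1 - t) *\<^sub>R z + t *\<^sub>R p" for z t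
  have slide_in: "slide z t \<in> A" if "z \<in> A" "t \<in> {0..1}" for z t
    unfolding slide_def using \<open>convex A\<close> that p by (intro convexD) auto
  have slide_strict: "snd u < fst u \<bullet> slide z t"
    if "z \<in> A \<inter> halfspace_plus u" "t \<in> {0<..<1}" for z t
  proof -
    have "(1 - t) * snd u \<le> (1 - t) * (fst u \<bullet> z)"
      using that by (intro mult_left_mono) (auto simp: halfspace_plus_def)
    moreover have "t * snd u < t * (fst u \<bullet> p)"
      using that p by (intro mult_strict_left_mono) auto
    ultimately show ?thesis
      by (simp add: slide_def inner_add_right algebra_simps)
  qed
  let ?g = "\<lambda>t. f (slide x t, u) - f (slide y t, u)"
  have "continuous_on {0..1} ?g"
    using x y u slide_in
    by (intro continuous_on_diff continuous_on_compose2[OF contf])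
      (auto simp: slide_def intro!: continuous_intros)
  then have "(?g \<longlongrightarrow> ?g 0) (at 0 within {0..1})"
    by (simp add: continuous_on_def)
  then have "(?g \<longlongrightarrow> ?g 0) (at_right 0)"
    by (simp add: at_within_Icc_at_right)
  moreover have "c < ?g 0"
    using gt eq by (simp add: slide_def)
  ultimately have "\<forall>\<^sub>F t in at_right 0. c < ?g t"
    by (rule order_tendstoD)
  moreover have "\<forall>\<^sub>F t in at_right 0. t \<in> {0<..<1::real}"
    by (rule eventually_at_right_real) simp
  ultimately have "\<forall>\<^sub>F t in at_right 0. c < ?g t \<and> t \<in> {0<..<1::real}"
    by (rule eventually_conj)
  then obtain t where t: "c < ?g t" "t \<in> {0<..<1}"
    using eventually_happens'[OF trivial_limit_at_right_real] by blast
  show ?thesis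
    using t slide_in[of x t] slide_in[of y t] slide_strict[OF x] slide_strict[OF y] x y
    by (intro bexI[of _ "slide x t"] bexI[of _ "slide y t"]) auto
qed

lemma openin_gap_gt:
  fixes A :: "'a::euclidean_space set"
  assumes "compact A" and "convex A"
    and contf: "continuous_on (A \<times> sphere 0 1) f"
    and single: "\<And>z H. z \<in> frontier A \<Longrightarrow> supporting_hyperplane_at A z H
      \<Longrightarrow> is_singleton (A \<inter> H)"
    and "0 \<le> c"
  shows "openin (top_of_set (sphere 0 1)) {u \<in> sphere 0 1. c < gap A f u}"
proof -
  define U where "U x y = {u \<in> sphere 0 1. snd u < fst u \<bullet> x \<and> snd u < fst u \<bullet> y
    \<and> c < f (x, u) - f (y, u)}" for x y
  have "openin (top_of_set (sphere 0 1)) (\<Union>x\<in>A. \<Union>y\<in>A. U x y)"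
    unfolding U_def using openin_strict_pair[OF contf] by (intro openin_Union) auto
  also have "(\<Union>x\<in>A. \<Union>y\<in>A. U x y) = {u \<in> sphere 0 1. c < gap A f u}" (is "_ = ?R")
  proof (intro subset_antisym subsetI)
    fix u assume "u \<in> (\<Union>x\<in>A. \<Union>y\<in>A. U x y)"
    then obtain x y where xy: "x \<in> A" "y \<in> A" "u \<in> U x y" by blast
    then have u: "u \<in> sphere 0 1" and gt: "c < f (x, u) - f (y, u)"
      by (auto simp: U_def)
    have "x \<in> A \<inter> halfspace_plus u" "y \<in> A \<inter> halfspace_plus u"
      using xy by (auto simp: U_def halfspace_plus_def)
    then have "f (x, u) - f (y, u) \<le> gap A f u"
      using gap_extremal[OF \<open>compact A\<close> contf u] by blast
    with u gt show "u \<in> ?R" by simp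
  next
    fix u assume "u \<in> ?R"
    then have u: "u \<in> sphere 0 1" and gt: "c < gap A f u" by auto
    from assms(1,2) contf single u \<open>0 \<le> c\<close> gt
    have "\<exists>x\<in>A. \<exists>y\<in>A. snd u < fst u \<bullet> x \<and> snd u < fst u \<bullet> y \<and> c < f (x, u) - f (y, u)"
      by (rule strict_pair_if_gap_gt)
    with u show "u \<in> (\<Union>x\<in>A. \<Union>y\<in>A. U x y)"
      by (auto simp: U_def)
  qed
  finally show ?thesis .
qed

lemma continuous_on_gap:
  fixes A :: "'a::euclidean_space set"
  assumes "compact A" and "convex A"
    and contf: "continuous_on (A \<times> sphere 0 1) f"
    and single: "\<And>z H. z \<in> frontier A \<Longrightarrow> supporting_hyperplane_at A z H
      \<Longrightarrow> is_singleton (A \<inter> H)"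
  shows "continuous_on (sphere 0 1) (gap A f)"
proof -
  let ?S = "sphere (0 :: 'a \<times> real) 1"
  have nonneg: "0 \<le> gap A f u" if "u \<in> ?S" for u
    using gap_nonneg[OF \<open>compact A\<close> contf that] .
  have gt: "openin (top_of_set ?S) {u \<in> ?S. c < gap A f u}" for c
  proof (cases "0 \<le> c")
    case True
    with assms show ?thesis by (rule openin_gap_gt)
  next
    case False
    then have "{u \<in> ?S. c < gap A f u} = ?S" using nonneg by force
    then show ?thesis by (metis openin_subtopology_self)
  qed
  have lt: "openin (top_of_set ?S) {u \<in> ?S. gap A f u < c}" for c
  proof (cases "0 < c")
    case True
    have "closedin (top_of_set ?S) {u \<in> ?S. c \<le> gap A f u}"
      using closed_gap_ge[OF \<open>compact A\<close> compact_sphere contf True]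
      by (intro closed_subset) auto
    then have "openin (top_of_set ?S) (?S - {u \<in> ?S. c \<le> gap A f u})"
      by (intro openin_diff openin_subtopology_self)
    moreover have "?S - {u \<in> ?S. c \<le> gap A f u} = {u \<in> ?S. gap A f u < c}"
      by auto
    ultimately show ?thesis by metis
  next
    case False
    then have "{u \<in> ?S. gap A f u < c} = {}" using nonneg by force
    then show ?thesis by (metis openin_empty)
  qed
  have "continuous_map (top_of_set ?S) euclideanreal (gap A f)"
    unfolding continuous_map_upper_lower_semicontinuous_lt using gt lt by simp
  then show ?thesis by simp
qed

theorem theorem2p1:
  fixes A :: "'n::finite \<Rightarrow> (real ^ 'n) set"
    and f :: "'n \<Rightarrow> (real ^ 'n) \<times> ((real ^ 'n) \<times> real) \<Rightarrow> real"
  assumes "\<And>i. compact (A i)"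
    and "\<And>i. convex (A i)"
    and "\<And>i. interior (A i) \<noteq> {}"
    and "\<And>i. continuous_on (UNIV \<times> sphere 0 1) (f i)"
    and "\<And>i x H. x \<in> frontier (A i) \<Longrightarrow> supporting_hyperplane_at (A i) x H
           \<Longrightarrow> is_singleton (A i \<inter> H)"
  shows "continuous_on (sphere 0 1) (psi A f)"
proof -
  have "continuous_on (A i \<times> sphere 0 1) (f i)" for i
    by (rule continuous_on_subset[OF assms(4)]) auto
  from assms(1,2) this assms(5) have "continuous_on (sphere 0 1) (gap (A i) (f i))" for i
    by (rule continuous_on_gap)
  then have "continuous_on (sphere 0 1) (\<lambda>u. \<chi> i. gap (A i) (f i) u)"
    by (rule continuous_on_vec_lambda)
  moreover have "psi A f = (\<lambda>u. \<chi> i. gap (A i) (f i) u)"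
    by (simp add: fun_eq_iff vec_eq_iff psi_nth)
  ultimately show ?thesis by simp
qed

end
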